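(* Let $Q \subset \mathbb{R}^M$ be a measurable set with $|Q|<\infty$, and let $U_n : Q\to\mathbb{R}^D$, $n = 1,2,\dots$, be a sequence of measurable functions that is strongly asymptotically stationary. Then $\{U_n\}_{n=1}^\infty$ is strongly (S)-convergent; in particular, for every $b \in C_c(\mathbb{R}^D)$ there is a function $\overline{b(U)}$ such that for every $w\in W$ $$\frac1{w_N}\sum_{n=1}^N w\!\left(\frac nN\right) b(U_n) \to \overline{b(U)} \quad\text{in } L^1(Q) \text{ as } N\to\infty.$$
   Context: $W = \{ w \in C^1[0,1] : w \ge 0,\ \int_0^1 w(z)\,dz = 1\}$, and for $w\in W$, $w_N = \sum_{n=1}^N w(n/N)$ (positive for all large $N$, since $w_N/N\to1$; only large $N$ matter). Strong asymptotic stationarity: $\{U_n\}$ is strongly asymptotically stationary if for every $b\in C_c(\mathbb{R}^D)$: - for every fixed $m$ the limit $\lim_{n\to\infty}\int_Q b(U_n)b(U_m)\,dy$ exists; and - there is a function $k\mapsto \omega(b,k)$ with $\omega(b,k)\to0$ as $k\to\infty$ such that $$\Big|\int_Q \big[ b(U_{k_1})b(U_{k_2}) - b(U_{k_1+n})b(U_{k_2+n})\big]dy\Big| \le \omega(b,k)$$ for all $1\le k\le k_1\le k_2$ and all $n\ge0$. Strong (S)-convergence: $\{U_n\}$ is strongly (S)-convergent if for every $b\in C_c(\mathbb{R}^D)$ and every $w \in W$: (a') for every fixed $m$ the limit $\lim_{N\to\infty} \frac1{w_N} \sum_{n=1}^N w(\frac nN)\int_Q b(U_n) b(U_m)\,dy$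 exists and is independent of $w$; and (b') the following limits exist and $$\lim_{N\to\infty} \frac1{w_N^2}\sum_{n,m=1}^N w(\tfrac nN) w(\tfrac mN)\int_Q b(U_n)b(U_m)\,dy = \lim_{M\to\infty} \frac1{w_M} \sum_{m=1}^M w(\tfrac mM)\Big[ \lim_{N\to\infty} \frac1{w_N} \sum_{n=1}^N w(\tfrac nN)\int_Q b(U_n) b(U_m)\,dy \Big].$$ *)

theory Defs
  imports "HOL-Analysis.Analysis"
begin

definition Cc :: "('b::real_normed_vector \<Rightarrow> real) set" where
  "Cc = {b. continuous_on UNIV b \<and> compact (closure {x. b x \<noteq> 0})}"

text \<open>Weights are total functions on the reals of which only the restriction to \<open>{0..1}\<close>
  matters; at the end points the derivative is one-sided.\<close>

definition C1_unit :: "(real \<Rightarrow> real) set" where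
  "C1_unit = {w. \<exists>w'. (\<forall>z\<in>{0..1}. (w has_real_derivative w' z) (at z within {0..1})) \<and>
                      continuous_on {0..1} w'}"

definition weights :: "(real \<Rightarrow> real) set" where
  "weights = {w \<in> C1_unit. (\<forall>z\<in>{0..1}. 0 \<le> w z) \<and> integral {0..1} w = 1}"

definition wsum :: "(real \<Rightarrow> real) \<Rightarrow> nat \<Rightarrow> real" where
  "wsum w N = (\<Sum>n=1..N. w (real n / real N))"

text \<open>For the finitely many \<open>N\<close> with \<open>wsum w N = 0\<close> the value of the average below is 0
  by the convention on division; only its limit as \<open>N\<close> tends to infinity is used.\<close>

definition wavg :: "(real \<Rightarrow> real) \<Rightarrow> (nat \<Rightarrow> real) \<Rightarrow> nat \<Rightarrow> real" where
  "wavg w x N = 1 / wsum w N * (\<Sum>n=1..N. w (real n / real N) * x n)"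

definition correlation ::
  "'a::euclidean_space set \<Rightarrow> (nat \<Rightarrow> 'a \<Rightarrow> 'b::real_normed_vector) \<Rightarrow> ('b \<Rightarrow> real) \<Rightarrow> nat \<Rightarrow> nat \<Rightarrow> real" where
  "correlation Q U b n m = (LINT y:Q|lebesgue. b (U n y) * b (U m y))"

text \<open>Sequences \<open>U\<close> are indexed from 1; the value \<open>U 0\<close> is never used.\<close>

definition strongly_asymptotically_stationary ::
  "'a::euclidean_space set \<Rightarrow> (nat \<Rightarrow> 'a \<Rightarrow> 'b::real_normed_vector) \<Rightarrow> bool" where
  "strongly_asymptotically_stationary Q U \<longleftrightarrow>
    (\<forall>b\<in>Cc.
      (\<forall>m\<ge>1. convergent (\<lambda>n. correlation Q U b n m)) \<and>
      (\<exists>\<omega> :: nat \<Rightarrow> real. \<omega> \<longlonglongrightarrow> 0 \<and>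
        (\<forall>k k1 k2 n. 1 \<le> k \<and> k \<le> k1 \<and> k1 \<le> k2 \<longrightarrow>
          \<bar>LINT y:Q|lebesgue. b (U k1 y) * b (U k2 y) - b (U (k1 + n) y) * b (U (k2 + n) y)\<bar>
            \<le> \<omega> k)))"

text \<open>The first conjunct guarantees that the inner limit written with \<open>lim\<close> in the
  second one exists.\<close>

definition strongly_S_convergent ::
  "'a::euclidean_space set \<Rightarrow> (nat \<Rightarrow> 'a \<Rightarrow> 'b::real_normed_vector) \<Rightarrow> bool" where
  "strongly_S_convergent Q U \<longleftrightarrow>
    (\<forall>b\<in>Cc.
      (\<forall>m\<ge>1. \<exists>L. \<forall>w\<in>weights. wavg w (\<lambda>n. correlation Q U b n m) \<longlonglongrightarrow> L) \<and>
      (\<forall>w\<in>weights.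
        let double_avg = (\<lambda>N. 1 / (wsum w N)\<^sup>2 *
              (\<Sum>n=1..N. \<Sum>m=1..N.
                w (real n / real N) * w (real m / real N) * correlation Q U b n m));
            iterated_avg = wavg w (\<lambda>m. lim (wavg w (\<lambda>n. correlation Q U b n m)))
        in convergent double_avg \<and> convergent iterated_avg \<and> lim double_avg = lim iterated_avg))"

definition L1_tendsto ::
  "'a::euclidean_space set \<Rightarrow> (nat \<Rightarrow> 'a \<Rightarrow> real) \<Rightarrow> ('a \<Rightarrow> real) \<Rightarrow> bool" where
  "L1_tendsto Q F g \<longleftrightarrow>
    (\<forall>N. set_integrable lebesgue Q (F N)) \<and> set_integrable lebesgue Q g \<and>
    (\<lambda>N. LINT y:Q|lebesgue. \<bar>F N y - g y\<bar>) \<longlonglongrightarrow> 0"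

end

theory Submission
  imports Defs
begin

text \<open>Letting the second index tend to infinity in the stationarity estimate shows that
  the limits \<open>l m\<close> of \<open>correlation Q U b n m\<close> as \<open>n\<close> tends to infinity form a Cauchy
  sequence; call its limit \<open>L\<close>.  By the same estimate the correlations themselves are close
  to \<open>L\<close> when both indices are large and far apart.  The weights near the axes and the
  diagonal are negligible, so every double average, even with two different weights \<open>w\<close> and
  \<open>v\<close> and two different lengths, tends to \<open>L\<close>.  Expanding the square, the
  \<open>L\<^sup>2\<close> distance between the \<open>w\<close>-average and the \<open>v\<close>-average tends to
  \<open>L - 2 * L + L = 0\<close>; hence the averages are Cauchy and their limit does not depend on
  the weight.\<close>

section \<open>Bounds for the weights and growth of their sums\<close>

lemma weights_nonneg:
  assumes "w \<in> weights" "1 \<le> n" "n \<le> N"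
  shows "0 \<le> w (real n / real N)"
  using assms by (auto simp: weights_def)

lemma wsum_nonneg: "w \<in> weights \<Longrightarrow> 0 \<le> wsum w N"
  unfolding wsum_def by (rule sum_nonneg) (simp add: weights_nonneg)

lemma weights_continuous: "w \<in> weights \<Longrightarrow> continuous_on {0..1} w"
  unfolding weights_def C1_unit_def using DERIV_continuous_on by blast

lemma weights_bounded:
  assumes "w \<in> weights"
  obtains C where "0 \<le> C" "\<And>n N. 1 \<le> n \<Longrightarrow> n \<le> N \<Longrightarrow> w (real n / real N) \<le> C"
proof -
  have "bounded (w ` {0..1})"
    by (intro compact_imp_bounded compact_continuous_image weights_continuous assms) simp
  then obtain C where C: "\<And>z. z \<in> {0..1} \<Longrightarrow> \<bar>w z\<bar> \<le> C"
    unfolding bounded_iff real_norm_def by blast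
  show thesis
  proof (rule that[of C])
    show "0 \<le> C" using C[of 0] by auto
    show "w (real n / real N) \<le> C" if "1 \<le> n" "n \<le> N" for n N
      using C[of "real n / real N"] that by auto
  qed
qed

text \<open>The continuous derivative is bounded on the compact interval, so the mean value
  inequality applies. The constant controls the Riemann sum error in
  \<open>wsum_lower_bound\<close>.\<close>

lemma weights_Lipschitz:
  assumes "w \<in> weights"
  obtains K where "0 \<le> K" "\<And>x y. x \<in> {0..1} \<Longrightarrow> y \<in> {0..1} \<Longrightarrow> \<bar>w x - w y\<bar> \<le> K * \<bar>x - y\<bar>"
proof -
  obtain w' where w': "\<And>z. z \<in> {0..1} \<Longrightarrow> (w has_real_derivative w' z) (at z within {0..1})"
    and c: "continuous_on {0..1} w'"
    using assms unfolding weights_def C1_unit_def by blast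
  have "bounded (w' ` {0..1})"
    by (intro compact_imp_bounded compact_continuous_image c) simp
  then obtain K where K: "\<And>z. z \<in> {0..1} \<Longrightarrow> \<bar>w' z\<bar> \<le> K"
    unfolding bounded_iff real_norm_def by blast
  show thesis
  proof (rule that[of K])
    show "0 \<le> K" using K[of 0] by auto
    show "\<bar>w x - w y\<bar> \<le> K * \<bar>x - y\<bar>" if "x \<in> {0..1}" "y \<in> {0..1}" for x y
      using field_differentiable_bound[of "{0..1}" w w' K x y] w' K that by auto
  qed
qed

text \<open>A Riemann sum comparison. On a cell of length \<open>1 / N\<close> the Lipschitz bound
  gives \<open>w\<close> at most its value at the right end plus \<open>K / N\<close>. Adding the
  integrals over the \<open>N\<close> cells yields \<open>1 \<le> (wsum w N + K) / N\<close>,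
  because \<open>w\<close> has integral 1.\<close>

lemma wsum_lower_bound:
  assumes "w \<in> weights"
  obtains K where "\<And>N. 1 \<le> N \<Longrightarrow> real N - K \<le> wsum w N"
proof -
  obtain K where K: "0 \<le> K" "\<And>x y. x \<in> {0..1} \<Longrightarrow> y \<in> {0..1} \<Longrightarrow> \<bar>w x - w y\<bar> \<le> K * \<bar>x - y\<bar>"
    using weights_Lipschitz[OF assms] by blast
  have int: "w integrable_on {a..b}" if "0 \<le> a" "b \<le> 1" for a b
    by (rule integrable_continuous_interval)
      (rule continuous_on_subset[OF weights_continuous[OF assms]], use that in auto)
  show thesis
  proof (rule that)
    fix N :: nat assume N: "1 \<le> N"
    have "integral {0..real j / real N} w \<le> (\<Sum>n=1..j. (w (real n / real N) + K / N) / N)"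
      if "j \<le> N" for j
      using that
    proof (induction j)
      case (Suc j)
      let ?a = "real j / real N" and ?b = "real (Suc j) / real N"
      have ab: "?a \<le> ?b" "?b \<le> 1" "?b - ?a = 1 / N" "0 \<le> ?a"
        using Suc.prems N by (auto simp: field_simps)
      have "integral {0..?b} w = integral {0..?a} w + integral {?a..?b} w"
        using Henstock_Kurzweil_Integration.integral_combine[of 0 ?a ?b w] int[of 0 ?b] ab by simp
      also have "integral {?a..?b} w \<le> integral {?a..?b} (\<lambda>_. w ?b + K / N)"
      proof (rule integral_le)
        show "w x \<le> w ?b + K / N" if x: "x \<in> {?a..?b}" for x
        proof -
          have "\<bar>w x - w ?b\<bar> \<le> K * \<bar>x - ?b\<bar>"
            by (rule K) (use x ab order_trans[of 0 ?a x] in \<open>auto simp del: of_nat_Suc\<close>)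
          also have "\<dots> \<le> K * (1 / N)"
            by (rule mult_left_mono) (use x ab K in auto)
          finally show ?thesis by simp
        qed
      qed (use int ab in auto)
      also have "\<dots> = (w ?b + K / N) / N"
        using ab by (simp del: of_nat_Suc)
      finally show ?case using Suc by simp
    qed simp
    from this[of N] have "1 \<le> (\<Sum>n=1..N. (w (real n / real N) + K / N) / N)"
      using assms N by (simp add: weights_def)
    also have "\<dots> = (wsum w N + K) / N"
      using N by (simp add: wsum_def sum.distrib flip: sum_divide_distrib)
    finally show "real N - K \<le> wsum w N" using N by (simp add: field_simps)
  qed
qed

lemma wsum_at_top:
  assumes "w \<in> weights"
  shows "filterlim (wsum w) at_top sequentially"
proof -
  obtain K where K: "\<And>N. 1 \<le> N \<Longrightarrow> real N - K \<le> wsum w N"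
    using wsum_lower_bound[OF assms] by blast
  show ?thesis
  proof (rule filterlim_at_top_mono)
    show "filterlim (\<lambda>N. - K + real N) at_top sequentially"
      by (intro filterlim_tendsto_add_at_top[OF tendsto_const] filterlim_real_sequentially)
    show "\<forall>\<^sub>F N in sequentially. - K + real N \<le> wsum w N"
      using eventually_ge_at_top[of 1] by eventually_elim (use K in auto)
  qed
qed

section \<open>Estimates for weighted sums and averages\<close>

text \<open>Terms outside the exceptional set \<open>S\<close> cost at most \<open>e\<close> times
  the total weight, and each of the at most \<open>s\<close> exceptional terms costs at most
  \<open>K * C\<close>. When \<open>s\<close> stays bounded, the second cost is negligible because
  \<open>wsum w N\<close> tends to infinity.\<close>

lemma weighted_sum_le:
  assumes w: "w \<in> weights" and C: "\<And>n. 1 \<le> n \<Longrightarrow> n \<le> N \<Longrightarrow> w (real n / real N) \<le> C"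
    and S: "finite S" "real (card S) \<le> s" and nonneg: "0 \<le> e" "0 \<le> K" "0 \<le> C"
    and K: "\<And>n. 1 \<le> n \<Longrightarrow> n \<le> N \<Longrightarrow> x n \<le> K"
    and e: "\<And>n. 1 \<le> n \<Longrightarrow> n \<le> N \<Longrightarrow> n \<notin> S \<Longrightarrow> x n \<le> e"
  shows "(\<Sum>n=1..N. w (real n / real N) * x n) \<le> e * wsum w N + K * C * s"
proof -
  have "(\<Sum>n=1..N. w (real n / real N) * x n)
      \<le> (\<Sum>n=1..N. e * w (real n / real N) + (if n \<in> S then K * C else 0))"
  proof (rule sum_mono)
    fix n assume "n \<in> {1..N}"
    then have n: "1 \<le> n" "n \<le> N" by auto
    have w0: "0 \<le> w (real n / real N)" by (rule weights_nonneg[OF w n])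
    show "w (real n / real N) * x n \<le> e * w (real n / real N) + (if n \<in> S then K * C else 0)"
    proof (cases "n \<in> S")
      case True
      have "w (real n / real N) * x n \<le> w (real n / real N) * K"
        by (rule mult_left_mono[OF K[OF n] w0])
      also have "\<dots> \<le> C * K" by (rule mult_right_mono[OF C[OF n] nonneg(2)])
      finally show ?thesis using True w0 nonneg by (simp add: mult.commute add_increasing)
    next
      case False
      then show ?thesis using mult_left_mono[OF e[OF n] w0] by (simp add: mult.commute)
    qed
  qed
  also have "\<dots> = e * wsum w N + K * C * real (card (S \<inter> {1..N}))"
    by (simp add: sum.distrib wsum_def sum_distrib_left sum.If_cases Int_commute)
  also have "real (card (S \<inter> {1..N})) \<le> s"
    using card_mono[OF S(1), of "S \<inter> {1..N}"] S(2) by auto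
  finally show ?thesis using nonneg by (simp add: mult_left_mono)
qed

lemma wavg_bounded:
  assumes w: "w \<in> weights" and B: "\<And>n. 1 \<le> n \<Longrightarrow> \<bar>x n\<bar> \<le> B" "0 \<le> B"
  shows "\<bar>wavg w x N\<bar> \<le> B"
\<comment> \<open>If the total weight vanishes, the average is 0 by the convention on division, and
  \<open>0 \<le> B\<close> closes this case.\<close>
proof (cases "wsum w N = 0")
  case False
  then have pos: "0 < wsum w N" using wsum_nonneg[OF w, of N] by simp
  have "\<bar>\<Sum>n=1..N. w (real n / real N) * x n\<bar> \<le> (\<Sum>n=1..N. w (real n / real N) * B)"
    by (rule order_trans[OF sum_abs], rule sum_mono)
      (use w B in \<open>auto simp: abs_mult weights_nonneg intro!: mult_left_mono\<close>)
  also have "\<dots> = wsum w N * B" by (simp add: wsum_def sum_distrib_right)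
  finally show ?thesis using pos by (simp add: wavg_def abs_mult field_simps)
qed (use B in \<open>simp add: wavg_def\<close>)

section \<open>Double averages of bounded arrays\<close>

text \<open>Weights and lengths are kept separate because the square of a difference of two averages
  contains mixed products. With \<open>v = w\<close> and \<open>M = N\<close> this is the double
  average in \<open>strongly_S_convergent\<close>.\<close>

definition double_wavg ::
  "(real \<Rightarrow> real) \<Rightarrow> (real \<Rightarrow> real) \<Rightarrow> (nat \<Rightarrow> nat \<Rightarrow> real) \<Rightarrow> nat \<Rightarrow> nat \<Rightarrow> real" where
  "double_wavg w v c N M = 1 / (wsum w N * wsum v M) *
     (\<Sum>n=1..N. \<Sum>m=1..M. w (real n / real N) * v (real m / real M) * c n m)"

text \<open>All rows but the first few are good, and in a good row the bad columns number at most
  \<open>k + 2 * P + 1\<close>. The bad entries therefore carry weight of order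
  \<open>wsum w N + wsum v M\<close>, against the total \<open>wsum w N * wsum v M\<close>.\<close>

lemma double_wavg_tendsto:
  assumes w: "w \<in> weights" and v: "v \<in> weights"
    and K: "\<And>n m. 1 \<le> n \<Longrightarrow> 1 \<le> m \<Longrightarrow> \<bar>c n m\<bar> \<le> K"
    and L: "\<And>e. 0 < e \<Longrightarrow> \<exists>k P. \<forall>n\<ge>k. \<forall>m\<ge>k. n + P \<le> m \<or> m + P \<le> n \<longrightarrow> \<bar>c n m - L\<bar> < e"
    and "0 < e"
  shows "\<exists>N0. \<forall>N\<ge>N0. \<forall>M\<ge>N0. \<bar>double_wavg w v c N M - L\<bar> < e"
proof -
  obtain Cw where Cw: "0 \<le> Cw" "\<And>n N. 1 \<le> n \<Longrightarrow> n \<le> N \<Longrightarrow> w (real n / real N) \<le> Cw"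
    using weights_bounded[OF w] by blast
  obtain Cv where Cv: "0 \<le> Cv" "\<And>n N. 1 \<le> n \<Longrightarrow> n \<le> N \<Longrightarrow> v (real n / real N) \<le> Cv"
    using weights_bounded[OF v] by blast
  obtain k P where kP: "\<And>n m. k \<le> n \<Longrightarrow> k \<le> m \<Longrightarrow> n + P \<le> m \<or> m + P \<le> n \<Longrightarrow> \<bar>c n m - L\<bar> < e / 4"
    using L[of "e/4"] \<open>0 < e\<close> by (metis zero_less_divide_iff zero_less_numeral)
  define J where "J = K + \<bar>L\<bar>"
  have d: "\<bar>c n m - L\<bar> \<le> J" if "1 \<le> n" "1 \<le> m" for n m
    using K[OF that] by (simp add: J_def)
  have J: "0 \<le> J" using d[of 1 1] by auto
  \<comment> \<open>\<open>a\<close> bounds the bad columns of one good row; \<open>b\<close> times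
    \<open>wsum v M\<close> bounds all bad rows. The choice of \<open>N0\<close> makes each of the
    two contributions at most a quarter of \<open>e\<close> times the total weight. With the quarter
    from the good entries this leaves a strict margin below \<open>e\<close>.\<close>
  define a where "a = J * Cv * (k + 2 * P + 1)"
  define b where "b = J * Cw * k"
  have ev: "\<forall>\<^sub>F N in sequentially. X < wsum u N" if "u \<in> weights" for X u
    using wsum_at_top[OF that] by (rule filterlim_at_top_dense[THEN iffD1, rule_format])
  have "\<forall>\<^sub>F N in sequentially. 0 < wsum w N \<and> 4 * b / e < wsum w N \<and> 0 < wsum v N \<and> 4 * a / e < wsum v N"
    by (intro eventually_conj ev w v)
  then obtain N0 where N0: "\<And>N. N0 \<le> N \<Longrightarrow>
      0 < wsum w N \<and> 4 * b / e < wsum w N \<and> 0 < wsum v N \<and> 4 * a / e < wsum v N"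
    unfolding eventually_sequentially by blast
  show ?thesis
  proof (intro exI[of _ N0] allI impI)
    fix N M assume N: "N0 \<le> N" and M: "N0 \<le> M"
    let ?W = "wsum w N" and ?V = "wsum v M"
    have row: "(\<Sum>m=1..M. v (real m / real M) * \<bar>c n m - L\<bar>) \<le> e / 4 * ?V + a"
      if n: "1 \<le> n" "k \<le> n" for n
      unfolding a_def
    proof (rule weighted_sum_le[OF v Cv(2)])
      \<comment> \<open>The columns near the axis and those within \<open>P\<close> of the diagonal.
        If \<open>P\<close> exceeds \<open>n\<close>, truncated subtraction only shortens the band,
        so the count stays valid.\<close>
      let ?S = "{..<k} \<union> {n - P..n + P}"
      show "finite ?S" by simp
      have "card ?S \<le> k + 2 * P + 1"
        by (rule order_trans[OF card_Un_le]) auto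
      then show "real (card ?S) \<le> real (k + 2 * P + 1)" by (rule of_nat_mono)
      show "\<bar>c n m - L\<bar> \<le> e / 4" if "1 \<le> m" "m \<le> M" "m \<notin> ?S" for m
        using kP[of n m] that n by (auto simp: not_le less_diff_conv intro: less_imp_le)
    qed (use d n J Cv \<open>0 < e\<close> in auto)
    have "(\<Sum>n=1..N. w (real n / real N) * (\<Sum>m=1..M. v (real m / real M) * \<bar>c n m - L\<bar>))
        \<le> (e / 4 * ?V + a) * ?W + J * ?V * Cw * k"
    proof (rule weighted_sum_le[OF w Cw(2)])
      show "finite {..<k}" "real (card {..<k}) \<le> k" by simp_all
      show "(\<Sum>m=1..M. v (real m / real M) * \<bar>c n m - L\<bar>) \<le> e / 4 * ?V + a"
        if "1 \<le> n" "n \<le> N" "n \<notin> {..<k}" for n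
        using row that by simp
      show "(\<Sum>m=1..M. v (real m / real M) * \<bar>c n m - L\<bar>) \<le> J * ?V" if "1 \<le> n" "n \<le> N" for n
        \<comment> \<open>With no exceptional indices the estimate reduces to the crude row bound,
          which serves as the bound \<open>K\<close> for the rows below \<open>k\<close>.\<close>
        using weighted_sum_le[OF v Cv(2), where S = "{}" and s = 0 and e = J and K = J
            and x = "\<lambda>m. \<bar>c n m - L\<bar>"] that d J Cv by simp
    qed (use J Cv Cw wsum_nonneg[OF v] \<open>0 < e\<close> in \<open>auto simp: a_def\<close>)
    also have "\<dots> = (e / 4) * ?W * ?V + a * ?W + b * ?V"
      by (simp add: b_def algebra_simps)
    also have "\<dots> < e * (?W * ?V)"
    proof -
      have "a * ?W \<le> (e * ?V / 4) * ?W" "b * ?V \<le> (e * ?W / 4) * ?V"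
        using N0[OF N] N0[OF M] \<open>0 < e\<close> by (auto simp: field_simps)
      moreover have "0 < e * (?W * ?V)" using N0[OF N] N0[OF M] \<open>0 < e\<close> by simp
      ultimately show ?thesis by (simp add: algebra_simps)
    qed
    finally have *: "(\<Sum>n=1..N. w (real n / real N) * (\<Sum>m=1..M. v (real m / real M) * \<bar>c n m - L\<bar>))
        < e * (?W * ?V)" .
    have pos: "0 < ?W * ?V" using N0[OF N] N0[OF M] by simp
    have WV: "?W * ?V * L = (\<Sum>n=1..N. \<Sum>m=1..M. w (real n / real N) * v (real m / real M) * L)"
      unfolding wsum_def sum_product by (simp add: sum_distrib_right)
    have "double_wavg w v c N M - L
        = ((\<Sum>n=1..N. \<Sum>m=1..M. w (real n / real N) * v (real m / real M) * c n m) - ?W * ?V * L) / (?W * ?V)"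
      using less_imp_neq[OF pos] by (simp add: double_wavg_def diff_divide_distrib del: mult_eq_0_iff)
    also have "\<dots> = (\<Sum>n=1..N. \<Sum>m=1..M. w (real n / real N) * v (real m / real M) * (c n m - L)) / (?W * ?V)"
      unfolding WV by (simp add: sum_subtractf right_diff_distrib)
    finally have eq: "\<bar>double_wavg w v c N M - L\<bar>
        = \<bar>\<Sum>n=1..N. \<Sum>m=1..M. w (real n / real N) * v (real m / real M) * (c n m - L)\<bar> / (?W * ?V)"
      using pos by (simp add: abs_divide)
    have "\<bar>\<Sum>n=1..N. \<Sum>m=1..M. w (real n / real N) * v (real m / real M) * (c n m - L)\<bar>
        \<le> (\<Sum>n=1..N. \<Sum>m=1..M. \<bar>w (real n / real N) * v (real m / real M) * (c n m - L)\<bar>)"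
      by (rule order_trans[OF sum_abs sum_mono[OF sum_abs]])
    also have "\<dots> = (\<Sum>n=1..N. w (real n / real N) * (\<Sum>m=1..M. v (real m / real M) * \<bar>c n m - L\<bar>))"
      by (auto simp: sum_distrib_left abs_mult weights_nonneg w v intro!: sum.cong)
    also have "\<dots> < e * (?W * ?V)" by (rule *)
    finally show "\<bar>double_wavg w v c N M - L\<bar> < e"
      unfolding eq pos_divide_less_eq[OF pos] .
  qed
qed

text \<open>A single average is the double average of an array that is constant in its second index,
  so this weighted Cesaro theorem is a special case of \<open>double_wavg_tendsto\<close>.\<close>

lemma wavg_tendsto:
  assumes w: "w \<in> weights" and x: "x \<longlonglongrightarrow> L"
  shows "wavg w x \<longlonglongrightarrow> L"
proof (rule LIMSEQ_I)
  fix e :: real assume e: "0 < e"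
  obtain K where K: "\<And>n. norm (x n) \<le> K"
    using convergent_imp_Bseq[OF convergentI[OF x]] unfolding Bseq_def by blast
  have "\<exists>k P. \<forall>n\<ge>k. \<forall>m\<ge>k. n + P \<le> m \<or> m + P \<le> n \<longrightarrow> \<bar>x n - L\<bar> < r" if "0 < r" for r
    using LIMSEQ_D[OF x that] by auto
  then have "\<exists>N0. \<forall>N\<ge>N0. \<forall>M\<ge>N0. \<bar>double_wavg w w (\<lambda>n m. x n) N M - L\<bar> < e"
    using K e by (intro double_wavg_tendsto[OF w w, where K = K]) auto
  then obtain N0 where N0: "\<And>N M. N0 \<le> N \<Longrightarrow> N0 \<le> M \<Longrightarrow> \<bar>double_wavg w w (\<lambda>n m. x n) N M - L\<bar> < e"
    by blast
  have "\<forall>\<^sub>F N in sequentially. 0 < wsum w N"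
    using wsum_at_top[OF w] by (rule filterlim_at_top_dense[THEN iffD1, rule_format])
  then obtain N1 where N1: "\<And>N. N1 \<le> N \<Longrightarrow> 0 < wsum w N"
    unfolding eventually_sequentially by blast
  have "double_wavg w w (\<lambda>n m. x n) N N = wavg w x N" if "N1 \<le> N" for N
  proof -
    have "(\<Sum>n=1..N. \<Sum>m=1..N. w (real n / real N) * w (real m / real N) * x n)
        = (\<Sum>n=1..N. w (real n / real N) * x n) * wsum w N"
      unfolding wsum_def sum_product by (intro sum.cong refl) (simp add: mult_ac)
    then show ?thesis using N1[OF that] by (simp add: double_wavg_def wavg_def)
  qed
  then show "\<exists>no. \<forall>n\<ge>no. norm (wavg w x n - L) < e"
    using N0 by (intro exI[of _ "max N0 N1"]) (metis max.bounded_iff real_norm_def)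
qed

section \<open>Limits of asymptotically stationary correlations\<close>

text \<open>The first conclusion serves the iterated average, the second is the hypothesis on
  \<open>c\<close> in \<open>double_wavg_tendsto\<close>; both have the same
  \<open>L\<close>.\<close>

lemma stationary_limits:
  fixes c :: "nat \<Rightarrow> nat \<Rightarrow> real"
  assumes sym: "\<And>n m. c n m = c m n"
    and l: "\<And>m. 1 \<le> m \<Longrightarrow> (\<lambda>n. c n m) \<longlonglongrightarrow> l m"
    and \<omega>: "\<omega> \<longlonglongrightarrow> 0"
    and shift: "\<And>k k1 k2 n. 1 \<le> k \<Longrightarrow> k \<le> k1 \<Longrightarrow> k1 \<le> k2 \<Longrightarrow> \<bar>c k1 k2 - c (k1 + n) (k2 + n)\<bar> \<le> \<omega> k"
  obtains L where "l \<longlonglongrightarrow> L"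
    "\<And>e. 0 < e \<Longrightarrow> \<exists>k P. \<forall>n\<ge>k. \<forall>m\<ge>k. n + P \<le> m \<or> m + P \<le> n \<longrightarrow> \<bar>c n m - L\<bar> < e"
proof -
  have l': "(\<lambda>p. c m (p + j)) \<longlonglongrightarrow> l m" if "1 \<le> m" for m j
    using LIMSEQ_ignore_initial_segment[OF l[OF that], of j] sym by simp
  \<comment> \<open>Shifting the pair \<open>(k, p + k)\<close> by \<open>j\<close> costs at most
    \<open>\<omega> k\<close>; then \<open>p\<close> tends to infinity.\<close>
  have step: "\<bar>l k - l (k + j)\<bar> \<le> \<omega> k" if k: "1 \<le> k" for k j
  proof (rule LIMSEQ_le_const2)
    show "(\<lambda>p. \<bar>c k (p + k) - c (k + j) (p + (k + j))\<bar>) \<longlonglongrightarrow> \<bar>l k - l (k + j)\<bar>"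
      by (intro tendsto_intros l') (use k in auto)
    show "\<exists>N. \<forall>n\<ge>N. \<bar>c k (n + k) - c (k + j) (n + (k + j))\<bar> \<le> \<omega> k"
      using shift[of k k "_ + k" j] k by (auto simp: add.assoc)
  qed
  \<comment> \<open>A single such \<open>k\<close> suffices, since the estimate with
    \<open>\<omega> k\<close> covers all indices from \<open>k\<close> on.\<close>
  have \<omega>': "\<exists>k\<ge>1. \<omega> k < e" if "0 < e" for e
    using LIMSEQ_D[OF \<omega> that] by (metis abs_ge_self diff_zero le_less_trans max.cobounded1 max.cobounded2 real_norm_def)
  have "Cauchy l"
  proof (rule CauchyI')
    fix e :: real assume "0 < e"
    then obtain k where k: "1 \<le> k" "\<omega> k < e / 2" using \<omega>'[of "e/2"] by auto
    show "\<exists>M. \<forall>m\<ge>M. \<forall>n>m. dist (l m) (l n) < e"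
    proof (intro exI[of _ k] allI impI)
      fix m n assume "k \<le> m" "m < n"
      then show "dist (l m) (l n) < e"
        using step[OF k(1), of "m - k"] step[OF k(1), of "n - k"] k(2) by (simp add: dist_real_def)
    qed
  qed
  then obtain L where L: "l \<longlonglongrightarrow> L" using Cauchy_convergent convergentD by blast
  have lL: "\<bar>l k - L\<bar> \<le> \<omega> k" if k: "1 \<le> k" for k
  proof (rule LIMSEQ_le_const2)
    show "(\<lambda>j. \<bar>l k - l (j + k)\<bar>) \<longlonglongrightarrow> \<bar>l k - L\<bar>"
      by (intro tendsto_intros LIMSEQ_ignore_initial_segment L)
  qed (use step[OF k] in \<open>auto simp: add.commute\<close>)
  \<comment> \<open>Sliding \<open>(n, m)\<close> down its diagonal until the first index is
    \<open>k\<close> leaves only one sequence, \<open>c k\<close>, to control, so \<open>P\<close>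
    depends on \<open>k\<close> but not on \<open>n\<close>. The three thirds of \<open>e\<close>
    pay for the slide, for the distance to \<open>l k\<close>, and for that from \<open>l k\<close>
    to \<open>L\<close>.\<close>
  have far: "\<exists>k P. \<forall>n\<ge>k. \<forall>m. n + P \<le> m \<longrightarrow> \<bar>c n m - L\<bar> < e" if e: "0 < e" for e
  proof -
    obtain k where k: "1 \<le> k" "\<omega> k < e / 3" using \<omega>'[of "e/3"] e by auto
    obtain P where P: "\<And>p. P \<le> p \<Longrightarrow> \<bar>c k (p + k) - l k\<bar> < e / 3"
      using LIMSEQ_D[OF l'[OF k(1)], of "e/3" k] e by auto
    have "\<bar>c n m - L\<bar> < e" if "k \<le> n" "n + P \<le> m" for n m
    proof -
      have "\<bar>c k (m - n + k) - c (k + (n - k)) (m - n + k + (n - k))\<bar> \<le> \<omega> k"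
        by (rule shift) (use k in auto)
      also have "c (k + (n - k)) (m - n + k + (n - k)) = c n m" using that by simp
      finally have "\<bar>c k (m - n + k) - c n m\<bar> \<le> \<omega> k" .
      moreover have "\<bar>c k (m - n + k) - l k\<bar> < e / 3" by (rule P) (use that in auto)
      ultimately show ?thesis using lL[OF k(1)] k(2) by linarith
    qed
    then show ?thesis by blast
  qed
  show thesis
  proof (rule that[OF L])
    fix e :: real assume "0 < e"
    then obtain k P where *: "\<And>n m. k \<le> n \<Longrightarrow> n + P \<le> m \<Longrightarrow> \<bar>c n m - L\<bar> < e" using far by blast
    show "\<exists>k P. \<forall>n\<ge>k. \<forall>m\<ge>k. n + P \<le> m \<or> m + P \<le> n \<longrightarrow> \<bar>c n m - L\<bar> < e"
      using * sym by (intro exI[of _ k] exI[of _ P]) metis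
  qed
qed

section \<open>Averages of functions: inner products and \<open>L^1\<close> limits\<close>

text \<open>This translates \<open>L^2\<close> inner products of averages into double averages of
  correlations, to which \<open>double_wavg_tendsto\<close> applies.\<close>

lemma integral_double_wavg:
  fixes f :: "nat \<Rightarrow> 'a \<Rightarrow> real"
  assumes "\<And>n m. 1 \<le> n \<Longrightarrow> 1 \<le> m \<Longrightarrow> integrable M (\<lambda>x. f n x * f m x)"
  shows "(\<integral>x. wavg w (\<lambda>n. f n x) N * wavg v (\<lambda>n. f n x) K \<partial>M)
    = double_wavg w v (\<lambda>n m. \<integral>x. f n x * f m x \<partial>M) N K"
proof -
  have "(\<integral>x. wavg w (\<lambda>n. f n x) N * wavg v (\<lambda>n. f n x) K \<partial>M)
    = (\<integral>x. 1 / (wsum w N * wsum v K) * (\<Sum>n=1..N. \<Sum>m=1..K.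
        w (real n / real N) * v (real m / real K) * (f n x * f m x)) \<partial>M)"
  proof (intro Bochner_Integration.integral_cong refl)
    fix x
    have "wavg w (\<lambda>n. f n x) N * wavg v (\<lambda>n. f n x) K = 1 / (wsum w N * wsum v K) *
        ((\<Sum>n=1..N. w (real n / real N) * f n x) * (\<Sum>m=1..K. v (real m / real K) * f m x))"
      by (simp add: wavg_def)
    also have "(\<Sum>n=1..N. w (real n / real N) * f n x) * (\<Sum>m=1..K. v (real m / real K) * f m x) =
        (\<Sum>n=1..N. \<Sum>m=1..K. w (real n / real N) * v (real m / real K) * (f n x * f m x))"
      unfolding sum_product by (intro sum.cong refl) (simp add: mult_ac)
    finally show "wavg w (\<lambda>n. f n x) N * wavg v (\<lambda>n. f n x) K = 1 / (wsum w N * wsum v K) *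
        (\<Sum>n=1..N. \<Sum>m=1..K. w (real n / real N) * v (real m / real K) * (f n x * f m x))" .
  qed
  also have "\<dots> = 1 / (wsum w N * wsum v K) * (\<integral>x. (\<Sum>n=1..N. \<Sum>m=1..K.
        w (real n / real N) * v (real m / real K) * (f n x * f m x)) \<partial>M)"
    by (rule integral_mult_right_zero)
  also have "(\<integral>x. (\<Sum>n=1..N. \<Sum>m=1..K.
        w (real n / real N) * v (real m / real K) * (f n x * f m x)) \<partial>M) = (\<Sum>n=1..N. \<Sum>m=1..K.
        \<integral>x. w (real n / real N) * v (real m / real K) * (f n x * f m x) \<partial>M)"
    by (subst Bochner_Integration.integral_sum | use assms in \<open>auto intro!: Bochner_Integration.integrable_sum sum.cong\<close>)+
  finally show ?thesis by (simp add: double_wavg_def)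
qed

context finite_measure
begin

text \<open>Integrates the pointwise bound of \<open>\<bar>h x\<bar>\<close> by
  \<open>e + (h x)\<^sup>2 / e\<close>, which comes from the square of
  \<open>\<bar>h x\<bar> - e\<close>. It plays the part of the Cauchy-Schwarz inequality in passing
  from \<open>L^2\<close> to \<open>L^1\<close>.\<close>

lemma integral_abs_le_square:
  fixes h :: "'a \<Rightarrow> real"
  assumes "integrable M h" "integrable M (\<lambda>x. (h x)\<^sup>2)" "0 < e"
  shows "(\<integral>x. \<bar>h x\<bar> \<partial>M) \<le> e * measure M (space M) + (\<integral>x. (h x)\<^sup>2 \<partial>M) / e"
proof -
  have "(\<integral>x. \<bar>h x\<bar> \<partial>M) \<le> (\<integral>x. e + (h x)\<^sup>2 / e \<partial>M)"
  proof (rule integral_mono)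
    fix x
    have "0 \<le> (\<bar>h x\<bar> - e)\<^sup>2" by simp
    then have "2 * (e * \<bar>h x\<bar>) \<le> e * e + (h x)\<^sup>2"
      by (simp add: power2_diff power2_eq_square[of e] mult_ac add_ac)
    moreover have "0 \<le> e * \<bar>h x\<bar>" using \<open>0 < e\<close> by simp
    ultimately have "e * \<bar>h x\<bar> \<le> e * e + (h x)\<^sup>2" by linarith
    then show "\<bar>h x\<bar> \<le> e + (h x)\<^sup>2 / e" using \<open>0 < e\<close> by (simp add: field_simps)
  qed (use assms in auto)
  also have "\<dots> = e * measure M (space M) + (\<integral>x. (h x)\<^sup>2 \<partial>M) / e"
    using assms by (subst Bochner_Integration.integral_add) (auto simp: mult.commute)
  finally show ?thesis .
qed

text \<open>A subsequence converges almost everywhere, dominated convergence with the bound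
  \<open>2 * B\<close> passes to its limit under the integral, and the Cauchy property carries the
  convergence over to the whole sequence.\<close>

lemma L1_complete_bounded:
  fixes F :: "nat \<Rightarrow> 'a \<Rightarrow> real"
  assumes F [measurable]: "\<And>N. F N \<in> borel_measurable M"
    and B: "\<And>N x. x \<in> space M \<Longrightarrow> \<bar>F N x\<bar> \<le> B"
    and Cauchy: "\<And>e. 0 < e \<Longrightarrow> \<exists>N0. \<forall>N\<ge>N0. \<forall>K\<ge>N0. (\<integral>x. \<bar>F N x - F K x\<bar> \<partial>M) < e"
  obtains g where "integrable M g" "(\<lambda>N. \<integral>x. \<bar>F N x - g x\<bar> \<partial>M) \<longlonglongrightarrow> 0"
proof -
  have intF: "integrable M (F N)" for N
    by (rule integrable_const_bound[of _ B]) (use B in auto)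
  obtain r where r: "strict_mono r" and AE: "AE x in M. Cauchy (\<lambda>i. F (r i) x)"
    by (rule cauchy_L1_AE_cauchy_subseq[OF intF]) (use Cauchy in auto)
  \<comment> \<open>Where the subsequence diverges \<open>lim\<close> is an unspecified value, but
    such points lie in a null set.\<close>
  define g where "g x = lim (\<lambda>i. F (r i) x)" for x
  have [measurable]: "g \<in> borel_measurable M" unfolding g_def by measurable
  have lim: "AE x in M. (\<lambda>i. F (r i) x) \<longlonglongrightarrow> g x"
    using AE by eventually_elim (simp add: g_def Cauchy_convergent convergent_LIMSEQ_iff[symmetric])
  have "AE x in M. \<bar>g x\<bar> \<le> B"
    using lim AE_space
  proof eventually_elim
    case (elim x)
    then show ?case using B by (intro LIMSEQ_le_const2[OF tendsto_rabs[OF elim(1)]]) auto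
  qed
  then have intg: "integrable M g" by (intro integrable_const_bound[of _ B]) auto
  have sub: "(\<lambda>i. \<integral>x. \<bar>F (r i) x - F N x\<bar> \<partial>M) \<longlonglongrightarrow> (\<integral>x. \<bar>g x - F N x\<bar> \<partial>M)" for N
  proof (rule integral_dominated_convergence)
    show "integrable M (\<lambda>_. 2 * B)" by simp
    show "AE x in M. (\<lambda>i. \<bar>F (r i) x - F N x\<bar>) \<longlonglongrightarrow> \<bar>g x - F N x\<bar>"
      using lim by eventually_elim (intro tendsto_intros)
    show "AE x in M. norm \<bar>F (r i) x - F N x\<bar> \<le> 2 * B" for i
    proof (rule AE_I2)
      fix x assume "x \<in> space M"
      from B[OF this, of "r i"] B[OF this, of N]
      show "norm \<bar>F (r i) x - F N x\<bar> \<le> 2 * B" by simp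
    qed
  qed measurable
  show thesis
  proof (rule that[OF intg], rule LIMSEQ_I)
    fix e :: real assume "0 < e"
    then obtain N0 where N0: "\<And>N K. N0 \<le> N \<Longrightarrow> N0 \<le> K \<Longrightarrow> (\<integral>x. \<bar>F N x - F K x\<bar> \<partial>M) < e / 2"
      using Cauchy[of "e / 2"] by auto
    have "(\<integral>x. \<bar>g x - F N x\<bar> \<partial>M) \<le> e / 2" if "N0 \<le> N" for N
    proof (rule LIMSEQ_le_const2[OF sub])
      show "\<exists>k. \<forall>n\<ge>k. (\<integral>x. \<bar>F (r n) x - F N x\<bar> \<partial>M) \<le> e / 2"
        using N0 that seq_suble[OF r] by (meson less_imp_le order_trans)
    qed
    then show "\<exists>no. \<forall>n\<ge>no. norm ((\<integral>x. \<bar>F n x - g x\<bar> \<partial>M) - 0) < e"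
      using \<open>0 < e\<close> by (intro exI[of _ N0]) (force simp: abs_minus_commute)
  qed
qed

text \<open>The limit \<open>g\<close> is built from the constant weight 1 alone. Any other weight
  reaches the same \<open>g\<close>, because its averages approach those of the constant weight in
  \<open>L^1\<close>.\<close>

lemma wavg_L1_convergent:
  fixes f :: "nat \<Rightarrow> 'a \<Rightarrow> real"
  assumes f [measurable]: "\<And>n. 1 \<le> n \<Longrightarrow> f n \<in> borel_measurable M"
    and B: "\<And>n x. 1 \<le> n \<Longrightarrow> x \<in> space M \<Longrightarrow> \<bar>f n x\<bar> \<le> B" "0 \<le> B"
    and D: "\<And>w v e. w \<in> weights \<Longrightarrow> v \<in> weights \<Longrightarrow> 0 < e \<Longrightarrow> \<exists>N0. \<forall>N\<ge>N0. \<forall>K\<ge>N0.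
      \<bar>double_wavg w v (\<lambda>n m. \<integral>x. f n x * f m x \<partial>M) N K - L\<bar> < e"
  obtains g where "integrable M g"
    "\<And>w. w \<in> weights \<Longrightarrow> (\<lambda>N. \<integral>x. \<bar>wavg w (\<lambda>n. f n x) N - g x\<bar> \<partial>M) \<longlonglongrightarrow> 0"
proof -
  define A where "A w N x = wavg w (\<lambda>n. f n x) N" for w N x
  let ?c = "\<lambda>n m. \<integral>x. f n x * f m x \<partial>M"
  have A [measurable]: "A w N \<in> borel_measurable M" for w N
    unfolding A_def wavg_def by (intro borel_measurable_times borel_measurable_sum borel_measurable_const f) auto
  have AB: "\<bar>A w N x\<bar> \<le> B" if "w \<in> weights" "x \<in> space M" for w N x
    unfolding A_def by (rule wavg_bounded) (use that B in auto)
  have intA: "integrable M (A w N)" if "w \<in> weights" for w N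
    by (rule integrable_const_bound[of _ B]) (use AB that in auto)
  have intAA: "integrable M (\<lambda>x. A w N x * A v K x)" if "w \<in> weights" "v \<in> weights" for w v N K
    by (rule integrable_const_bound[of _ "B * B"]) (use AB that B(2) in \<open>auto simp: abs_mult intro!: mult_mono\<close>)
  have intff: "integrable M (\<lambda>x. f n x * f m x)" if "1 \<le> n" "1 \<le> m" for n m
    by (rule integrable_const_bound[of _ "B * B"])
      (use B f that in \<open>auto simp: abs_mult intro!: mult_mono borel_measurable_times\<close>)
  have AA: "(\<integral>x. A w N x * A v K x \<partial>M) = double_wavg w v ?c N K" for w v N K
    unfolding A_def by (rule integral_double_wavg[OF intff])
  have sq: "(A w N x - A v K x)\<^sup>2 = A w N x * A w N x - 2 * (A w N x * A v K x) + A v K x * A v K x" for w v N K x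
    by (simp add: power2_eq_square algebra_simps)
  have L2: "\<exists>N0. \<forall>N\<ge>N0. \<forall>K\<ge>N0. (\<integral>x. (A w N x - A v K x)\<^sup>2 \<partial>M) < e"
    if w: "w \<in> weights" and v: "v \<in> weights" and "0 < e" for w v e
  proof -
    \<comment> \<open>Quarters, because the mixed term enters the expanded square twice.\<close>
    have e: "0 < e / 4" using \<open>0 < e\<close> by simp
    obtain N1 where N1: "\<And>N K. N1 \<le> N \<Longrightarrow> N1 \<le> K \<Longrightarrow> \<bar>double_wavg w w ?c N K - L\<bar> < e / 4"
      using D[OF w w e] by blast
    obtain N2 where N2: "\<And>N K. N2 \<le> N \<Longrightarrow> N2 \<le> K \<Longrightarrow> \<bar>double_wavg w v ?c N K - L\<bar> < e / 4"
      using D[OF w v e] by blast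
    obtain N3 where N3: "\<And>N K. N3 \<le> N \<Longrightarrow> N3 \<le> K \<Longrightarrow> \<bar>double_wavg v v ?c N K - L\<bar> < e / 4"
      using D[OF v v e] by blast
    have "(\<integral>x. (A w N x - A v K x)\<^sup>2 \<partial>M) < e"
      if "max N1 (max N2 N3) \<le> N" "max N1 (max N2 N3) \<le> K" for N K
    proof -
      have "(\<integral>x. (A w N x - A v K x)\<^sup>2 \<partial>M)
          = double_wavg w w ?c N N - 2 * double_wavg w v ?c N K + double_wavg v v ?c K K"
        unfolding sq by (simp add: intAA w v flip: AA)
      then show ?thesis using N1[of N N] N2[of N K] N3[of K K] that by (simp add: abs_if split: if_splits)
    qed
    then show ?thesis by blast
  qed
  have L1: "\<exists>N0. \<forall>N\<ge>N0. \<forall>K\<ge>N0. (\<integral>x. \<bar>A w N x - A v K x\<bar> \<partial>M) < e"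
    if w: "w \<in> weights" and v: "v \<in> weights" and e: "0 < e" for w v e
  proof -
    \<comment> \<open>Chosen so that \<open>d = e / m\<close> makes the first term of
      \<open>integral_abs_le_square\<close> less than \<open>e / 2\<close>; the added 1 keeps
      \<open>m\<close> positive on a null space. An \<open>L^2\<close> error below
      \<open>d * (e / 2)\<close> then handles the other term.\<close>
    define m where "m = 2 * (measure M (space M) + 1)"
    have m: "0 < m" "2 * measure M (space M) < m" by (auto simp: m_def add_nonneg_pos)
    define d where "d = e / m"
    have d: "0 < d" "d * measure M (space M) < e / 2" using m e by (auto simp: d_def field_simps)
    obtain N0 where N0: "\<And>N K. N0 \<le> N \<Longrightarrow> N0 \<le> K \<Longrightarrow> (\<integral>x. (A w N x - A v K x)\<^sup>2 \<partial>M) < d * (e / 2)"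
      using L2[OF w v, of "d * (e / 2)"] d(1) e by auto
    have "(\<integral>x. \<bar>A w N x - A v K x\<bar> \<partial>M) < e" if "N0 \<le> N" "N0 \<le> K" for N K
    proof -
      have "(\<integral>x. \<bar>A w N x - A v K x\<bar> \<partial>M)
          \<le> d * measure M (space M) + (\<integral>x. (A w N x - A v K x)\<^sup>2 \<partial>M) / d"
        by (rule integral_abs_le_square) (use intA intAA w v d in \<open>auto simp: sq\<close>)
      also have "(\<integral>x. (A w N x - A v K x)\<^sup>2 \<partial>M) / d < e / 2"
        using N0[OF that] d(1) by (simp add: field_simps)
      finally show ?thesis using d(2) by linarith
    qed
    then show ?thesis by blast
  qed
  have one: "(\<lambda>_. 1) \<in> weights"
    by (auto simp: weights_def C1_unit_def intro!: exI[of _ "\<lambda>_. 0"] continuous_intros)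
  obtain g where g: "integrable M g" "(\<lambda>N. \<integral>x. \<bar>A (\<lambda>_. 1) N x - g x\<bar> \<partial>M) \<longlonglongrightarrow> 0"
    by (rule L1_complete_bounded[OF A AB[OF one] L1[OF one one]])
  have "(\<lambda>N. \<integral>x. \<bar>A w N x - g x\<bar> \<partial>M) \<longlonglongrightarrow> 0" if w: "w \<in> weights" for w
  proof (rule tendsto_sandwich[OF _ _ tendsto_const])
    have "(\<lambda>N. \<integral>x. \<bar>A w N x - A (\<lambda>_. 1) N x\<bar> \<partial>M) \<longlonglongrightarrow> 0"
    proof (rule LIMSEQ_I)
      fix e :: real assume "0 < e"
      from L1[OF w one this]
      show "\<exists>no. \<forall>n\<ge>no. norm ((\<integral>x. \<bar>A w n x - A (\<lambda>_. 1) n x\<bar> \<partial>M) - 0) < e"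
        by auto
    qed
    from tendsto_add[OF this g(2)]
    show "(\<lambda>N. (\<integral>x. \<bar>A w N x - A (\<lambda>_. 1) N x\<bar> \<partial>M) + (\<integral>x. \<bar>A (\<lambda>_. 1) N x - g x\<bar> \<partial>M)) \<longlonglongrightarrow> 0"
      by simp
    show "\<forall>\<^sub>F N in sequentially. (\<integral>x. \<bar>A w N x - g x\<bar> \<partial>M)
        \<le> (\<integral>x. \<bar>A w N x - A (\<lambda>_. 1) N x\<bar> \<partial>M) + (\<integral>x. \<bar>A (\<lambda>_. 1) N x - g x\<bar> \<partial>M)"
    proof (rule always_eventually, rule allI)
      fix N
      have "(\<integral>x. \<bar>A w N x - g x\<bar> \<partial>M) \<le> (\<integral>x. \<bar>A w N x - A (\<lambda>_. 1) N x\<bar> + \<bar>A (\<lambda>_. 1) N x - g x\<bar> \<partial>M)"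
        by (rule integral_mono) (use intA w one g(1) in auto)
      then show "(\<integral>x. \<bar>A w N x - g x\<bar> \<partial>M)
          \<le> (\<integral>x. \<bar>A w N x - A (\<lambda>_. 1) N x\<bar> \<partial>M) + (\<integral>x. \<bar>A (\<lambda>_. 1) N x - g x\<bar> \<partial>M)"
        using intA[OF w] intA[OF one] g(1) by simp
    qed
  qed (simp add: always_eventually)
  then show thesis using that[OF g(1)] by (simp add: A_def)
qed

end

section \<open>Test functions and the convergence theorem for \<open>U\<close>\<close>

lemma Cc_bounded:
  assumes "b \<in> Cc"
  obtains B where "0 \<le> B" "\<And>z. \<bar>b z\<bar> \<le> B"
proof -
  let ?S = "closure {x. b x \<noteq> 0}"
  have "bounded (b ` ?S)"
    using assms by (intro compact_imp_bounded compact_continuous_image)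
      (auto simp: Cc_def intro: continuous_on_subset)
  then obtain B where B: "\<And>z. z \<in> ?S \<Longrightarrow> \<bar>b z\<bar> \<le> B"
    unfolding bounded_iff real_norm_def by blast
  show thesis
  \<comment> \<open>If the support is empty, \<open>B\<close> is arbitrary and may be
    negative.\<close>
  proof (rule that[of "max B 0"])
    show "\<bar>b z\<bar> \<le> max B 0" for z
    proof (cases "b z = 0")
      case False
      then have "z \<in> ?S" by (auto intro: closure_subset[THEN subsetD])
      then show ?thesis using B[of z] by simp
    qed simp
  qed simp
qed

theorem theorem4p6:
  fixes Q :: "(real ^ 'm) set"
    and U :: "nat \<Rightarrow> real ^ 'm \<Rightarrow> real ^ 'd"
  assumes "Q \<in> sets lebesgue"
    and "emeasure lebesgue Q < \<infinity>"
    and "\<And>n. 1 \<le> n \<Longrightarrow> U n \<in> borel_measurable (lebesgue_on Q)"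
    and "strongly_asymptotically_stationary Q U"
  shows "strongly_S_convergent Q U \<and>
    (\<forall>b\<in>Cc. \<exists>bU. \<forall>w\<in>weights.
      L1_tendsto Q (\<lambda>N y. wavg w (\<lambda>n. b (U n y)) N) bU)"
proof -
  interpret finite_measure "lebesgue_on Q"
    by (rule finite_measure_lebesgue_on) (use assms(1,2) in \<open>simp add: fmeasurable_def\<close>)
  have Q: "Q \<inter> space lebesgue \<in> sets lebesgue" using assms(1) by simp
  have LINT: "(LINT y:Q|lebesgue. h y) = (\<integral>y. h y \<partial>lebesgue_on Q)" for h :: "real ^ 'm \<Rightarrow> real"
    unfolding set_lebesgue_integral_def by (rule integral_restrict_space[OF Q, symmetric])
  have INT: "set_integrable lebesgue Q h \<longleftrightarrow> integrable (lebesgue_on Q) h" for h :: "real ^ 'm \<Rightarrow> real"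
    unfolding set_integrable_def by (rule integrable_restrict_space[OF Q, symmetric])
  \<comment> \<open>The witnesses precede the quantifier over weights, which gives the independence
    of \<open>w\<close> in both conclusions of the theorem.\<close>
  have main: "\<exists>l L bU. (\<forall>m\<ge>1. (\<lambda>n. correlation Q U b n m) \<longlonglongrightarrow> l m) \<and> l \<longlonglongrightarrow> L \<and>
      (\<forall>w\<in>weights. (\<lambda>N. double_wavg w w (correlation Q U b) N N) \<longlonglongrightarrow> L) \<and>
      (\<forall>w\<in>weights. L1_tendsto Q (\<lambda>N y. wavg w (\<lambda>n. b (U n y)) N) bU)"
    if b: "b \<in> Cc" for b
  proof -
    obtain B where B: "0 \<le> B" "\<And>z. \<bar>b z\<bar> \<le> B" using Cc_bounded[OF b] by blast
    have meas: "(\<lambda>y. b (U n y)) \<in> borel_measurable (lebesgue_on Q)" if "1 \<le> n" for n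
      by (rule measurable_compose[OF assms(3)[OF that]])
        (use b in \<open>auto simp: Cc_def intro: borel_measurable_continuous_onI\<close>)
    let ?c = "correlation Q U b"
    have c: "?c = (\<lambda>n m. \<integral>y. b (U n y) * b (U m y) \<partial>lebesgue_on Q)"
      by (simp add: correlation_def LINT fun_eq_iff)
    have prod_le: "\<bar>b (U n y) * b (U m y)\<bar> \<le> B * B" for n m y
      unfolding abs_mult using B by (intro mult_mono) auto
    have int: "integrable (lebesgue_on Q) (\<lambda>y. b (U n y) * b (U m y))" if "1 \<le> n" "1 \<le> m" for n m
      by (rule integrable_const_bound[of _ "B * B"])
        (use prod_le meas that in \<open>auto intro!: borel_measurable_times\<close>)
    have K: "\<bar>?c n m\<bar> \<le> B * B * measure (lebesgue_on Q) (space (lebesgue_on Q))" if "1 \<le> n" "1 \<le> m" for n m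
    proof -
      have "\<bar>?c n m\<bar> \<le> (\<integral>y. B * B \<partial>lebesgue_on Q)"
        unfolding c by (rule order_trans[OF integral_abs_bound integral_mono])
          (use int[OF that] prod_le in auto)
      then show ?thesis by (simp add: mult.commute)
    qed
    from assms(4) b obtain \<omega> where conv: "\<And>m. 1 \<le> m \<Longrightarrow> convergent (\<lambda>n. ?c n m)"
      and \<omega>: "\<omega> \<longlonglongrightarrow> 0"
      and st: "\<And>k k1 k2 n. 1 \<le> k \<Longrightarrow> k \<le> k1 \<Longrightarrow> k1 \<le> k2 \<Longrightarrow>
        \<bar>LINT y:Q|lebesgue. b (U k1 y) * b (U k2 y) - b (U (k1 + n) y) * b (U (k2 + n) y)\<bar> \<le> \<omega> k"
      unfolding strongly_asymptotically_stationary_def by blast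
    \<comment> \<open>Stationarity bounds the integral of a difference; integrability of both
      products turns it into a difference of correlations.\<close>
    have shift: "\<bar>?c k1 k2 - ?c (k1 + n) (k2 + n)\<bar> \<le> \<omega> k" if "1 \<le> k" "k \<le> k1" "k1 \<le> k2" for k k1 k2 n
      using st[OF that, of n] that unfolding LINT c
      by (subst (asm) Bochner_Integration.integral_diff) (auto intro!: int)
    define l where "l m = lim (\<lambda>n. ?c n m)" for m
    have l: "(\<lambda>n. ?c n m) \<longlonglongrightarrow> l m" if "1 \<le> m" for m
      unfolding l_def using conv[OF that] by (simp add: convergent_LIMSEQ_iff)
    obtain L where L: "l \<longlonglongrightarrow> L"
      "\<And>e. 0 < e \<Longrightarrow> \<exists>k P. \<forall>n\<ge>k. \<forall>m\<ge>k. n + P \<le> m \<or> m + P \<le> n \<longrightarrow> \<bar>?c n m - L\<bar> < e"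
      by (rule stationary_limits[OF _ l \<omega> shift]) (simp_all add: c mult.commute)
    have D: "\<exists>N0. \<forall>N\<ge>N0. \<forall>K\<ge>N0. \<bar>double_wavg w v ?c N K - L\<bar> < e"
      if "w \<in> weights" "v \<in> weights" "0 < e" for w v e
      by (rule double_wavg_tendsto[OF that(1,2) K L(2) that(3)])
    obtain g where g: "integrable (lebesgue_on Q) g" "\<And>w. w \<in> weights \<Longrightarrow>
        (\<lambda>N. \<integral>y. \<bar>wavg w (\<lambda>n. b (U n y)) N - g y\<bar> \<partial>lebesgue_on Q) \<longlonglongrightarrow> 0"
      by (rule wavg_L1_convergent[OF meas B(2) B(1) D[unfolded c]]) (assumption | rule that)+
    have "L1_tendsto Q (\<lambda>N y. wavg w (\<lambda>n. b (U n y)) N) g" if w: "w \<in> weights" for w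
    proof -
      \<comment> \<open>\<open>L1_tendsto\<close> asks for integrability at every \<open>N\<close>;
        \<open>wavg_bounded\<close> also covers those with zero total weight.\<close>
      have "integrable (lebesgue_on Q) (\<lambda>y. wavg w (\<lambda>n. b (U n y)) N)" for N
      proof (rule integrable_const_bound)
        show "AE y in lebesgue_on Q. norm (wavg w (\<lambda>n. b (U n y)) N) \<le> B"
          using wavg_bounded[OF w] B by auto
        show "(\<lambda>y. wavg w (\<lambda>n. b (U n y)) N) \<in> borel_measurable (lebesgue_on Q)"
          unfolding wavg_def
          by (intro borel_measurable_times borel_measurable_sum borel_measurable_const meas) auto
      qed
      then show ?thesis using g(1) g(2)[OF w] by (simp add: L1_tendsto_def LINT INT)
    qed
    moreover have "(\<lambda>N. double_wavg w w ?c N N) \<longlonglongrightarrow> L" if "w \<in> weights" for w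
      by (rule LIMSEQ_I) (use D[OF that that] in fastforce)
    ultimately show ?thesis using l L(1) by blast
  qed
  have "strongly_S_convergent Q U"
    unfolding strongly_S_convergent_def Let_def
  proof (intro ballI conjI allI impI)
    fix b :: "real ^ 'd \<Rightarrow> real" assume b: "b \<in> Cc"
    let ?c = "correlation Q U b"
    from main[OF b] obtain l L where l: "\<And>m. 1 \<le> m \<Longrightarrow> (\<lambda>n. ?c n m) \<longlonglongrightarrow> l m" and L: "l \<longlonglongrightarrow> L"
      and D: "\<And>w. w \<in> weights \<Longrightarrow> (\<lambda>N. double_wavg w w ?c N N) \<longlonglongrightarrow> L" by blast
    show "\<exists>L. \<forall>w\<in>weights. wavg w (\<lambda>n. ?c n m) \<longlonglongrightarrow> L" if "1 \<le> m" for m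
      using wavg_tendsto l[OF that] by blast
    fix w assume w: "w \<in> weights"
    let ?d = "\<lambda>N. 1 / (wsum w N)\<^sup>2 *
      (\<Sum>n=1..N. \<Sum>m=1..N. w (real n / real N) * w (real m / real N) * ?c n m)"
    let ?i = "wavg w (\<lambda>m. lim (wavg w (\<lambda>n. ?c n m)))"
    have d: "?d \<longlonglongrightarrow> L" using D[OF w] by (simp add: double_wavg_def power2_eq_square)
    have "lim (wavg w (\<lambda>n. ?c n m)) = l m" if "1 \<le> m" for m
      by (rule limI[OF wavg_tendsto[OF w l[OF that]]])
    \<comment> \<open>Averages start at index 1, so agreement of the inner limits with
      \<open>l\<close> for \<open>1 \<le> m\<close> is enough.\<close>
    then have "?i = wavg w l" by (simp add: wavg_def fun_eq_iff)
    then have i: "?i \<longlonglongrightarrow> L" using wavg_tendsto[OF w L] by simp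
    show "convergent ?d" "convergent ?i" using d i by (auto intro: convergentI)
    show "lim ?d = lim ?i" using limI[OF d] limI[OF i] by simp
  qed
  then show ?thesis using main by blast
qed

end
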